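(* (Greedy minibatches, non-smooth case.) Let $f:\mathbb{R}^n\to\mathbb{R}$ be differentiable and $\mathbf{M}$-smooth for a symmetric positive definite matrix $\mathbf{M}$, i.e. $f(\mathbf{x}+\mathbf{h})\le f(\mathbf{x})+\langle\nabla f(\mathbf{x}),\mathbf{h}\rangle+\frac12\langle\mathbf{M}\mathbf{h},\mathbf{h}\rangle$ for all $\mathbf{x},\mathbf{h}\in\mathbb{R}^n$. Let $g(\mathbf{x})=\sum_{i=1}^ng_i(x_i)$ with $g_i:\mathbb{R}\to\mathbb{R}\cup\{+\infty\}$, and let $F=f+g$ have a global minimizer $\mathbf{x}^*$ with $F(\mathbf{x}^* )>-\infty$. Put $\xi(\mathbf{x})=F(\mathbf{x})-F(\mathbf{x}^* )$ and $\mathcal{X}^*=\operatorname{argmin}F$. Fix $\tau\in\{1,\dots,n\}$, let $L_\tau:=\max_{S\subseteq[n],|S|=\tau}\lambda_{\max}(\mathbf{M}_S)$, and for $\mathbf{x}\in\mathrm{dom}(g)$ let $$\lambda_i(\mathbf{x}):=-L_\tau\min_{v\in\mathbb{R}}\left\{\nabla_if(\mathbf{x})v+\tfrac{L_\tau}{2}v^2+g_i(x_i+v)-g_i(x_i)\right\},\qquad\lambda(\mathbf{x}):=\sum_{i=1}^n\lambda_i(\mathbf{x}),$$ and $\mu(\mathbf{x}):=\lambda(\mathbf{x})/\xi(\mathbf{x})$ for $\mathbf{x}\in\mathrm{dom}(g)\setminus\mathcal{X}^*$. Let $\mathbf{x}^0\in\mathrm{dom}(g)$ and for $k=0,\dots,K-1$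 let $S_k\in\operatorname{argmax}_{S\subseteq[n],|S|=\tau}\sum_{i\in S}\lambda_i(\mathbf{x}^k)$, and let $x^{k+1}_i=x^k_i+v_i^k$ for $i\in S_k$, where $v_i^k$ is a minimizer in the definition of $\lambda_i(\mathbf{x}^k)$, and $x^{k+1}_i=x^k_i$ for $i\notin S_k$. Let $\epsilon>0$. Then: (a) if $\mu>0$ and $\mu(\mathbf{x})\ge\mu$ for all $\mathbf{x}\in\mathrm{dom}(g)\setminus\mathcal{X}^*$, then $K\ge\frac{nL_\tau}{\mu\tau}\log\left(\frac{\xi(\mathbf{x}^0)}{\epsilon}\right)$ implies $\xi(\mathbf{x}^K)\le\epsilon$; (b) if $\rho:\mathbb{R}^n\to(0,\infty)$ is such that $\mu(\mathbf{x})\ge\rho(\mathbf{y})\,\xi(\mathbf{x})$ for all $\mathbf{x},\mathbf{y}\in\mathrm{dom}(g)\setminus\mathcal{X}^*$ with $\xi(\mathbf{x})\le\xi(\mathbf{y})$, then $K\ge\frac{nL_\tau}{\rho(\mathbf{x}^0)\tau\epsilon}$ implies $\xi(\mathbf{x}^K)\le\epsilon$; (c) with no further assumption on $F$, $K\ge\frac{\xi(\mathbf{x}^0)\,nL_\tau}{\tau\epsilon}\log\left(\frac{\xi(\mathbf{x}^0)}{\epsilon}\right)$ implies that $\xi(\mathbf{x}^K)\le\epsilon$ or there is $k\in\{0,\dots,K-1\}$ with $\lambda(\mathbf{x}^k)\le\epsilon$.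
   Context: $[n]=\{1,\dots,n\}$; $\lambda_{\max}$ is the largest eigenvalue; $\mathbf{M}_S$ is the principal submatrix of $\mathbf{M}$ with rows and columns in $S$; $\nabla_if$ is the $i$-th partial derivative; $\mathrm{dom}(g)=\{\mathbf{x}:g(\mathbf{x})<+\infty\}$. The one-dimensional minima defining $\lambda_i$ are assumed to be attained. Note that $\lambda(\mathbf{x})=-L_\tau\min_{\mathbf{y}\in\mathbb{R}^n}\{\langle\nabla f(\mathbf{x}),\mathbf{y}\rangle+\frac{L_\tau}2\|\mathbf{y}\|^2+g(\mathbf{x}+\mathbf{y})-g(\mathbf{x})\}$ by separability. Conventions: $\log0:=-\infty$, $0\log0:=0$. *)

theory Defs
  imports "HOL-Analysis.Analysis"
begin

(* Logarithm with the convention log 0 = -\<infinity>; the convention 0 log 0 = 0 is then the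
   product 0 * (-\<infinity>) = 0 of type ereal. *)
definition elog :: "ereal \<Rightarrow> ereal" where
  "elog a = (if a \<le> 0 then - \<infinity> else if a = \<infinity> then \<infinity> else ereal (ln (real_of_ereal a)))"

definition spd :: "real^'n^'n \<Rightarrow> bool" where
  "spd M \<longleftrightarrow> transpose M = M \<and> (\<forall>h. h \<noteq> 0 \<longrightarrow> 0 < (M *v h) \<bullet> h)"

(* c is an eigenvalue of the principal submatrix of M with rows and columns in S, which acts
   on real vectors indexed by S; values of v outside S are irrelevant. *)
definition principal_eigenvalue :: "real^'n^'n \<Rightarrow> 'n set \<Rightarrow> real \<Rightarrow> bool" where
  "principal_eigenvalue M S c \<longleftrightarrow>
     (\<exists>v :: 'n \<Rightarrow> real. (\<exists>i\<in>S. v i \<noteq> 0) \<and> (\<forall>i\<in>S. (\<Sum>j\<in>S. M $ i $ j * v j) = c * v i))"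

definition lambda_max :: "real^'n^'n \<Rightarrow> 'n set \<Rightarrow> real" where
  "lambda_max M S = Max {c. principal_eigenvalue M S c}"

definition L_tau :: "real^'n^'n \<Rightarrow> nat \<Rightarrow> real" where
  "L_tau M \<tau> = Max (lambda_max M ` {S. card S = \<tau>})"

definition partial_deriv :: "(real^'n \<Rightarrow> real) \<Rightarrow> 'n \<Rightarrow> real^'n \<Rightarrow> real" where
  "partial_deriv f i x = deriv (\<lambda>t. f (x + t *\<^sub>R axis i 1)) 0"

definition grad :: "(real^'n \<Rightarrow> real) \<Rightarrow> real^'n \<Rightarrow> real^'n" where
  "grad f x = (\<chi> i. partial_deriv f i x)"

definition matrix_smooth :: "real^'n^'n \<Rightarrow> (real^'n \<Rightarrow> real) \<Rightarrow> bool" where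
  "matrix_smooth M f \<longleftrightarrow>
     (\<forall>x h. f (x + h) \<le> f x + grad f x \<bullet> h + 1 / 2 * ((M *v h) \<bullet> h))"

definition sep_sum :: "('n \<Rightarrow> real \<Rightarrow> ereal) \<Rightarrow> real^'n \<Rightarrow> ereal" where
  "sep_sum g x = (\<Sum>i\<in>UNIV. g i (x $ i))"

definition edom :: "('a \<Rightarrow> ereal) \<Rightarrow> 'a set" where
  "edom h = {x. h x < \<infinity>}"

definition argmin_set :: "('a \<Rightarrow> ereal) \<Rightarrow> 'a set" where
  "argmin_set F = {x. is_arg_min F (\<lambda>_. True) x}"

definition objective :: "(real^'n \<Rightarrow> real) \<Rightarrow> ('n \<Rightarrow> real \<Rightarrow> ereal) \<Rightarrow> real^'n \<Rightarrow> ereal" where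
  "objective f g x = ereal (f x) + sep_sum g x"

definition coord_model ::
    "(real^'n \<Rightarrow> real) \<Rightarrow> ('n \<Rightarrow> real \<Rightarrow> ereal) \<Rightarrow> real \<Rightarrow> 'n \<Rightarrow> real^'n \<Rightarrow> real \<Rightarrow> ereal" where
  "coord_model f g L i x v =
     ereal (partial_deriv f i x * v + L / 2 * v\<^sup>2) + g i (x $ i + v) - g i (x $ i)"

(* Written as an infimum; it is the minimum of the model whenever that minimum is attained. *)
definition lam_coord ::
    "(real^'n \<Rightarrow> real) \<Rightarrow> ('n \<Rightarrow> real \<Rightarrow> ereal) \<Rightarrow> real \<Rightarrow> 'n \<Rightarrow> real^'n \<Rightarrow> ereal" where
  "lam_coord f g L i x = - ereal L * (INF v. coord_model f g L i x v)"

definition lam ::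
    "(real^'n \<Rightarrow> real) \<Rightarrow> ('n \<Rightarrow> real \<Rightarrow> ereal) \<Rightarrow> real \<Rightarrow> real^'n \<Rightarrow> ereal" where
  "lam f g L x = (\<Sum>i\<in>UNIV. lam_coord f g L i x)"

end

(* A step only moves coordinates in S_k, where <M h, h> <= L_tau |h|^2 by the Rayleigh bound, so
   smoothness makes the objective drop by at least (1 / L_tau) sum_{i in S_k} lambda_i(x^k). The
   greedy S_k carries at least the fraction tau / n of the total, whence
   xi(x^{k+1}) <= xi(x^k) - tau / (n L_tau) lambda(x^k). Bounding lambda below by m xi in (a) and by
   rho(x^0) xi^2 in (b) gives geometric decay of xi and linear growth of 1 / xi. In (c), as long as
   lambda(x^k) > eps, one has lambda(x^k) >= (eps / xi(x^0)) xi(x^k), which is the situation of (a). *)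
theory Submission
  imports Defs
begin

section \<open>Rayleigh bound for principal submatrices\<close>

lemma symmetric_matrix_inner:
  fixes M :: "real^'n^'n"
  assumes "transpose M = M"
  shows "(M *v a) \<bullet> b = a \<bullet> (M *v b)"
  by (metis assms dot_lmul_matrix transpose_matrix_vector)

lemma matrix_vector_mult_supported:
  fixes M :: "real^'n^'n"
  assumes "\<And>j. j \<notin> S \<Longrightarrow> h $ j = 0"
  shows "(M *v h) $ i = (\<Sum>j\<in>S. M $ i $ j * h $ j)"
  unfolding matrix_vector_mult_def
  by (auto intro!: sum.mono_neutral_right simp: assms)

lemma inner_supported:
  fixes a h :: "real^'n"
  assumes "\<And>j. j \<notin> S \<Longrightarrow> h $ j = 0"
  shows "a \<bullet> h = (\<Sum>j\<in>S. a $ j * h $ j)"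
  unfolding inner_vec_def
  by (auto intro!: sum.mono_neutral_right simp: assms)

text \<open>Extension by zero turns an eigenvector of the submatrix into a vector of the whole
  space, where inner products and orthogonality are available.\<close>

lemma principal_eigenvalue_iff_supported:
  fixes M :: "real^'n^'n"
  shows "principal_eigenvalue M S c \<longleftrightarrow>
    (\<exists>u. u \<noteq> 0 \<and> (\<forall>i. i \<notin> S \<longrightarrow> u $ i = 0) \<and> (\<forall>i\<in>S. (M *v u) $ i = c * u $ i))"
    (is "_ \<longleftrightarrow> ?R")
proof
  assume "principal_eigenvalue M S c"
  then obtain v where v: "\<exists>i\<in>S. v i \<noteq> 0" "\<forall>i\<in>S. (\<Sum>j\<in>S. M $ i $ j * v j) = c * v i"
    unfolding principal_eigenvalue_def by blast
  define u :: "real^'n" where "u = (\<chi> i. if i \<in> S then v i else 0)"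
  have "u \<noteq> 0" using v(1) by (auto simp: u_def vec_eq_iff)
  moreover have "\<forall>i. i \<notin> S \<longrightarrow> u $ i = 0" by (simp add: u_def)
  moreover have "\<forall>i\<in>S. (M *v u) $ i = c * u $ i"
    using v(2) by (simp add: matrix_vector_mult_supported[where S=S] u_def)
  ultimately show ?R by blast
next
  assume ?R
  then obtain u where u: "u \<noteq> 0" "\<forall>i. i \<notin> S \<longrightarrow> u $ i = 0" "\<forall>i\<in>S. (M *v u) $ i = c * u $ i"
    by blast
  have "\<exists>i\<in>S. u $ i \<noteq> 0" using u(1,2) by (auto simp: vec_eq_iff)
  moreover have "\<forall>i\<in>S. (\<Sum>j\<in>S. M $ i $ j * u $ j) = c * u $ i"
    using u(2,3) by (simp add: matrix_vector_mult_supported[where S=S])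
  ultimately show "principal_eigenvalue M S c"
    unfolding principal_eigenvalue_def by (intro exI[of _ "\<lambda>i. u $ i"]) blast
qed

text \<open>Eigenvectors to distinct eigenvalues are orthogonal, hence independent, and an
  independent set in \<open>real^'n\<close> is finite. Finiteness makes the \<open>Max\<close> in
  \<open>lambda_max\<close> a genuine upper bound.\<close>

lemma finite_principal_eigenvalues:
  fixes M :: "real^'n^'n"
  assumes sym: "transpose M = M"
  shows "finite {c. principal_eigenvalue M S c}"
proof -
  let ?E = "{c. principal_eigenvalue M S c}"
  define e where "e c = (SOME u. u \<noteq> 0 \<and> (\<forall>i. i \<notin> S \<longrightarrow> u $ i = 0) \<and>
    (\<forall>i\<in>S. (M *v u) $ i = c * u $ i))" for c
  have e: "e c \<noteq> 0 \<and> (\<forall>i. i \<notin> S \<longrightarrow> e c $ i = 0) \<and> (\<forall>i\<in>S. (M *v e c) $ i = c * e c $ i)"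
    if "c \<in> ?E" for c
    unfolding e_def
    by (rule someI_ex) (use that principal_eigenvalue_iff_supported[of M S c] in auto)
  \<comment> \<open>\<open>M *v e c\<close> may be nonzero outside \<open>S\<close>, but
    \<open>e d\<close> vanishes there, so only the coordinates governed by the eigenvalue equation
    enter.\<close>
  have Me: "(M *v e c) \<bullet> e d = c * (e c \<bullet> e d)" if "c \<in> ?E" "d \<in> ?E" for c d
    using e[OF that(1)] e[OF that(2)]
    by (simp add: inner_supported[where S=S and h="e d"] sum_distrib_left mult.assoc)
  have orth: "e c \<bullet> e d = 0" if "c \<in> ?E" "d \<in> ?E" "c \<noteq> d" for c d
  proof -
    have "c * (e c \<bullet> e d) = d * (e c \<bullet> e d)"
      using Me[OF that(1,2)] Me[OF that(2,1)] symmetric_matrix_inner[OF sym, of "e c" "e d"]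
      by (simp add: inner_commute)
    then show ?thesis using that(3) by simp
  qed
  have "inj_on e ?E"
  proof (rule inj_onI)
    fix c d assume cd: "c \<in> ?E" "d \<in> ?E" "e c = e d"
    \<comment> \<open>For \<open>c \<noteq> d\<close> the common vector would be orthogonal to
      itself, hence zero.\<close>
    then show "c = d" using orth[of c d] e[of d] by force
  qed
  moreover have "finite (e ` ?E)"
  proof (rule independent_imp_finite, rule pairwise_orthogonal_independent)
    show "pairwise orthogonal (e ` ?E)"
      unfolding pairwise_image by (auto simp: pairwise_def orthogonal_def intro: orth)
    show "0 \<notin> e ` ?E" using e by force
  qed
  ultimately show ?thesis by (rule finite_imageD[rotated])
qed

text \<open>The dominant eigenvector of the principal submatrix is a maximiser \<open>u\<close> of the Rayleigh
  quotient over the vectors supported in \<open>S\<close>: the form \<open>c \<bar>h\<bar>\<^sup>2 - \<langle>M h, h\<rangle>\<close> is nonnegative there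
  and vanishes at \<open>u\<close>, so its first variation at \<open>u\<close> vanishes.\<close>

lemma exists_dominant_principal_eigenvalue:
  fixes M :: "real^'n^'n"
  assumes sym: "transpose M = M" and S: "S \<noteq> {}"
  obtains c where "principal_eigenvalue M S c"
    "\<And>h. (\<And>i. i \<notin> S \<Longrightarrow> h $ i = 0) \<Longrightarrow> (M *v h) \<bullet> h \<le> c * (h \<bullet> h)"
proof -
  define V :: "(real^'n) set" where "V = {h. \<forall>i. i \<notin> S \<longrightarrow> h $ i = 0}"
  have "V = (\<Inter>i\<in>-S. {h. h $ i = 0})" by (auto simp: V_def)
  moreover have "closed {h :: real^'n. h $ i = 0}" for i
    by (intro closed_Collect_eq continuous_intros)
  ultimately have "closed V" by auto
  then have comp: "compact (sphere 0 1 \<inter> V)" by (intro compact_Int_closed) auto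
  obtain i0 where i0: "i0 \<in> S" using S by blast
  have ne: "sphere 0 1 \<inter> V \<noteq> {}"
  proof -
    have "axis i0 1 \<in> V" using i0 by (auto simp: V_def axis_def)
    moreover have "axis i0 (1::real) \<in> sphere 0 1" by simp
    ultimately show ?thesis by blast
  qed
  have "continuous_on (sphere 0 1 \<inter> V) (\<lambda>h. (M *v h) \<bullet> h)"
    by (intro continuous_intros linear_continuous_on matrix_vector_mul_bounded_linear)
  from continuous_attains_sup[OF comp ne this] obtain u where
    u: "norm u = 1" "u \<in> V" and
    umax: "\<And>h. norm h = 1 \<Longrightarrow> h \<in> V \<Longrightarrow> (M *v h) \<bullet> h \<le> (M *v u) \<bullet> u" by auto
  define c where "c = (M *v u) \<bullet> u"
  have ray: "(M *v h) \<bullet> h \<le> c * (h \<bullet> h)" if "h \<in> V" for h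
  proof (cases "h = 0")
    case False
    define w where "w = (1 / norm h) *\<^sub>R h"
    have "norm w = 1" "w \<in> V" using False that by (auto simp: w_def V_def)
    then have "(M *v w) \<bullet> w \<le> c" using umax c_def by blast
    moreover have "(M *v w) \<bullet> w = ((M *v h) \<bullet> h) / (norm h)\<^sup>2"
      by (simp add: w_def matrix_vector_mult_scaleR power2_eq_square)
    ultimately show ?thesis using False
      by (simp add: divide_le_eq power2_norm_eq_inner)
  qed simp
  have "(M *v u) $ i = c * u $ i" if i: "i \<in> S" for i
  proof (rule ccontr)
    define h :: "real^'n" where "h = axis i 1"
    \<comment> \<open>Along the line \<open>u + t *\<^sub>R h\<close> the form becomes a quadratic
      polynomial in \<open>t\<close> with constant term 0, linear coefficient \<open>2 * b\<close>
      and leading coefficient \<open>q\<close>.\<close>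
    define b where "b = c * (u \<bullet> h) - (M *v u) \<bullet> h"
    define q where "q = c * (h \<bullet> h) - (M *v h) \<bullet> h"
    assume "(M *v u) $ i \<noteq> c * u $ i"
    then have b0: "b \<noteq> 0" by (simp add: b_def h_def inner_axis)
    have hV: "h \<in> V" using i by (auto simp: h_def V_def axis_def)
    have exp: "0 \<le> 2 * t * b + t\<^sup>2 * q" for t
    proof -
      have "u + t *\<^sub>R h \<in> V" using hV u(2) by (auto simp: V_def)
      from ray[OF this] have "0 \<le> c * ((u + t *\<^sub>R h) \<bullet> (u + t *\<^sub>R h)) -
          (M *v (u + t *\<^sub>R h)) \<bullet> (u + t *\<^sub>R h)" by simp
      also have "\<dots> = c * (u \<bullet> u) - (M *v u) \<bullet> u + 2 * t * b + t\<^sup>2 * q"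
        using symmetric_matrix_inner[OF sym, of h u]
        by (simp add: b_def q_def matrix_vector_mult_scaleR matrix_vector_right_distrib
            inner_commute algebra_simps power2_eq_square)
      also have "c * (u \<bullet> u) - (M *v u) \<bullet> u = 0"
        using u(1) by (simp add: c_def norm_eq_1)
      finally show ?thesis by simp
    qed
    have q0: "q \<ge> 0" using ray[OF hV] by (simp add: q_def)
    \<comment> \<open>For \<open>q > 0\<close> the polynomial has its minimum at
      \<open>- b / q\<close>. Since \<open>q\<close> may vanish, 1 is added to the denominator; the
      value stays negative.\<close>
    define t where "t = - b / (q + 1)"
    have b: "b = - (t * (q + 1))" and "t \<noteq> 0" using q0 b0 by (auto simp: t_def)
    have "2 * t * b + t\<^sup>2 * q = - (t\<^sup>2 * (q + 2))"
      unfolding b by (simp add: power2_eq_square algebra_simps)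
    also have "\<dots> < 0" using \<open>t \<noteq> 0\<close> q0 by simp
    finally show False using exp[of t] by simp
  qed
  moreover have "u \<noteq> 0" using u(1) by auto
  ultimately have "principal_eigenvalue M S c"
    using u(2) unfolding principal_eigenvalue_iff_supported V_def by blast
  then show thesis using that ray by (simp add: V_def)
qed

text \<open>The dominant eigenvalue for \<open>S\<close> is one of the candidates in the maximum
  over eigenvalues, and \<open>S\<close> itself is one in the maximum over sets of its size.\<close>

lemma rayleigh_le_L_tau:
  fixes M :: "real^'n^'n"
  assumes sym: "transpose M = M" and S: "S \<noteq> {}" and h: "\<And>i. i \<notin> S \<Longrightarrow> h $ i = 0"
  shows "(M *v h) \<bullet> h \<le> L_tau M (card S) * (h \<bullet> h)"
proof -
  obtain c where c: "principal_eigenvalue M S c" "(M *v h) \<bullet> h \<le> c * (h \<bullet> h)"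
    using exists_dominant_principal_eigenvalue[OF sym S] h by metis
  have "c \<le> lambda_max M S"
    unfolding lambda_max_def using c(1) finite_principal_eigenvalues[OF sym] by (intro Max_ge) auto
  also have "\<dots> \<le> L_tau M (card S)" unfolding L_tau_def by (intro Max_ge) auto
  finally show ?thesis using c(2) by (meson inner_ge_zero mult_right_mono order_trans)
qed

text \<open>The Rayleigh bound is tested on a coordinate vector: it gives a diagonal entry of
  \<open>M\<close>, which is positive by definiteness.\<close>

lemma L_tau_pos:
  fixes M :: "real^'n^'n"
  assumes M: "spd M" and \<tau>: "\<tau> \<in> {1..CARD('n)}"
  shows "L_tau M \<tau> > 0"
proof -
  obtain S :: "'n set" where S: "card S = \<tau>"
    using \<tau> obtain_subset_with_card_n[of \<tau> UNIV] by auto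
  then obtain i where i: "i \<in> S" using \<tau> by fastforce
  have "0 < (M *v axis i 1) \<bullet> axis i 1" using M by (simp add: spd_def axis_eq_0_iff)
  also have "\<dots> \<le> L_tau M \<tau> * (axis i 1 \<bullet> (axis i 1 :: real^'n))"
    unfolding S[symmetric]
  proof (rule rayleigh_le_L_tau)
    show "transpose M = M" using M by (simp add: spd_def)
    show "S \<noteq> {}" using i by blast
    show "axis i 1 $ j = (0::real)" if "j \<notin> S" for j using i that by (auto simp: axis_def)
  qed
  finally show ?thesis by (simp add: inner_axis)
qed

section \<open>Coordinate models and descent of a block step\<close>

lemma sep_sum_finite:
  assumes g: "\<And>i t. g i t \<noteq> - \<infinity>" and y: "y \<in> edom (sep_sum g)"
  shows "g i (y $ i) = ereal (real_of_ereal (g i (y $ i)))"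
proof -
  have "sep_sum g y \<noteq> \<infinity>" using y by (auto simp: edom_def)
  then have "g i (y $ i) \<noteq> \<infinity>" by (auto simp: sep_sum_def sum_Pinfty)
  then show ?thesis using g[of i "y $ i"] by (cases "g i (y $ i)") auto
qed

text \<open>The trial step 0 has model value 0, so the minimum is at most 0 and the minimizer stays
  where \<open>g i\<close> is finite. Solving the minimum value \<open>- l / L\<close> for the new
  value of \<open>g i\<close> gives the last equation.\<close>

lemma coord_model_min:
  fixes x :: "real^'n"
  assumes g: "\<And>i t. g i t \<noteq> - \<infinity>" and x: "x \<in> edom (sep_sum g)" and L: "L > 0"
    and w: "is_arg_min (coord_model f g L i x) (\<lambda>_. True) w"
  defines "l \<equiv> real_of_ereal (lam_coord f g L i x)"
  shows "lam_coord f g L i x = ereal l" "0 \<le> l"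
    "g i (x $ i + w) = ereal (real_of_ereal (g i (x $ i)) - partial_deriv f i x * w - L / 2 * w\<^sup>2 - l / L)"
proof -
  define a where "a = real_of_ereal (g i (x $ i))"
  have a: "g i (x $ i) = ereal a" using sep_sum_finite[OF g x] a_def by simp
  have le: "coord_model f g L i x w \<le> coord_model f g L i x t" for t
    using w by (auto simp: is_arg_min_linorder)
  have z: "coord_model f g L i x 0 = 0" by (simp add: coord_model_def a)
  have "g i (x $ i + w) \<noteq> \<infinity>" using le[of 0] z by (auto simp: coord_model_def a)
  then obtain G where G: "g i (x $ i + w) = ereal G"
    using g[of i "x $ i + w"] by (cases "g i (x $ i + w)") auto
  define m where "m = partial_deriv f i x * w + L / 2 * w\<^sup>2 + G - a"
  have cm: "coord_model f g L i x w = ereal m" by (simp add: coord_model_def a G m_def)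
  have "(INF v. coord_model f g L i x v) = coord_model f g L i x w"
    using le by (intro antisym INF_lower INF_greatest) auto
  then have lc: "lam_coord f g L i x = ereal (- L * m)" by (simp add: lam_coord_def cm)
  then have l: "l = - L * m" by (simp add: l_def)
  show "lam_coord f g L i x = ereal l" using lc l by simp
  have "m \<le> 0" using le[of 0] z cm by simp
  then show "0 \<le> l" using l L by (simp add: mult_nonneg_nonpos)
  have "l / L = - m" using l L by simp
  then show "g i (x $ i + w) = ereal (real_of_ereal (g i (x $ i)) - partial_deriv f i x * w - L / 2 * w\<^sup>2 - l / L)"
    using G a m_def by simp
qed

lemma objective_finite:
  assumes g: "\<And>i t. g i t \<noteq> - \<infinity>" and y: "y \<in> edom (sep_sum g)"
  shows "objective f g y = ereal (f y + (\<Sum>i\<in>UNIV. real_of_ereal (g i (y $ i))))"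
proof -
  have "sep_sum g y = (\<Sum>i\<in>UNIV. ereal (real_of_ereal (g i (y $ i))))"
    unfolding sep_sum_def by (intro sum.cong refl sep_sum_finite[OF g y])
  then show ?thesis by (simp add: objective_def)
qed

text \<open>The Rayleigh bound replaces the coupled quadratic term by a sum over the coordinates in
  \<open>S\<close>. The linear and quadratic terms then cancel against those in the new values of
  \<open>g i\<close>, leaving only the gains divided by \<open>L\<close>.\<close>

lemma block_step_descent:
  fixes M :: "real^'n^'n" and f :: "real^'n \<Rightarrow> real"
  assumes M: "spd M" and smooth: "matrix_smooth M f" and g: "\<And>i t. g i t \<noteq> - \<infinity>"
    and S: "S \<noteq> {}" and L: "L = L_tau M (card S)" and x: "x \<in> edom (sep_sum g)"
    and w: "\<And>i. i \<in> S \<Longrightarrow> is_arg_min (coord_model f g L i x) (\<lambda>_. True) (w i)"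
    and y: "\<And>i. y $ i = (if i \<in> S then x $ i + w i else x $ i)"
  shows "y \<in> edom (sep_sum g)"
    "real_of_ereal (objective f g y) \<le> real_of_ereal (objective f g x)
       - (\<Sum>i\<in>S. real_of_ereal (lam_coord f g L i x)) / L"
proof -
  have "card S \<le> CARD('n)" by (simp add: card_mono)
  then have L0: "L > 0" unfolding L using S by (intro L_tau_pos[OF M]) (auto simp: Suc_le_eq card_gt_0_iff)
  define h :: "real^'n" where "h = (\<chi> i. if i \<in> S then w i else 0)"
  define a where "a i = real_of_ereal (g i (x $ i))" for i
  define l where "l i = real_of_ereal (lam_coord f g L i x)" for i
  define p where "p i = partial_deriv f i x" for i
  have yx: "y = x + h" using y by (auto simp: vec_eq_iff h_def)
  have gy: "g i (y $ i) = ereal (a i - (if i \<in> S then p i * w i + L / 2 * (w i)\<^sup>2 + l i / L else 0))" for i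
  proof (cases "i \<in> S")
    case True
    then show ?thesis using coord_model_min(3)[OF g x L0 w[OF True]] y[of i]
      by (simp add: a_def l_def p_def algebra_simps)
  next
    case False
    then show ?thesis using sep_sum_finite[OF g x, of i] y[of i] by (simp add: a_def)
  qed
  show dom: "y \<in> edom (sep_sum g)" by (simp add: edom_def sep_sum_def gy)
  have sup: "i \<notin> S \<Longrightarrow> h $ i = 0" for i by (simp add: h_def)
  have gh: "grad f x \<bullet> h = (\<Sum>i\<in>S. p i * w i)"
    using inner_supported[where h=h and S=S, OF sup] by (simp add: grad_def h_def p_def)
  have "h \<bullet> h = (\<Sum>i\<in>S. (w i)\<^sup>2)"
    using inner_supported[where h=h and S=S, OF sup] by (simp add: h_def power2_eq_square)
  then have Mh: "(M *v h) \<bullet> h \<le> L * (\<Sum>i\<in>S. (w i)\<^sup>2)"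
    using rayleigh_le_L_tau[of M S h] M S L sup by (auto simp: spd_def)
  have "f y \<le> f x + grad f x \<bullet> h + 1 / 2 * ((M *v h) \<bullet> h)"
    using smooth yx by (auto simp: matrix_smooth_def)
  also have "\<dots> \<le> f x + (\<Sum>i\<in>S. p i * w i) + L / 2 * (\<Sum>i\<in>S. (w i)\<^sup>2)"
    using gh Mh by simp
  finally have fy: "f y \<le> f x + (\<Sum>i\<in>S. p i * w i) + L / 2 * (\<Sum>i\<in>S. (w i)\<^sup>2)" .
  have "(\<Sum>i\<in>UNIV. real_of_ereal (g i (y $ i)))
      = (\<Sum>i\<in>UNIV. a i) - (\<Sum>i\<in>S. p i * w i + L / 2 * (w i)\<^sup>2 + l i / L)"
    by (simp add: gy sum_subtractf sum.If_cases)
  also have "\<dots> = (\<Sum>i\<in>UNIV. a i) - ((\<Sum>i\<in>S. p i * w i) + L / 2 * (\<Sum>i\<in>S. (w i)\<^sup>2) + (\<Sum>i\<in>S. l i) / L)"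
    by (simp add: sum.distrib sum_distrib_left sum_divide_distrib)
  finally show "real_of_ereal (objective f g y) \<le> real_of_ereal (objective f g x)
       - (\<Sum>i\<in>S. real_of_ereal (lam_coord f g L i x)) / L"
    using fy by (simp add: objective_finite[OF g dom] objective_finite[OF g x] a_def l_def)
qed

section \<open>Averaging over a best subset, and real recurrences\<close>

text \<open>Exchanging one index of a best \<open>\<tau>\<close>-subset for one outside shows that every weight inside
  dominates every weight outside.\<close>

lemma best_subset_ge_average:
  fixes l :: "'n::finite \<Rightarrow> real"
  assumes S: "card S = \<tau>" and best: "\<And>T. card T = \<tau> \<Longrightarrow> sum l T \<le> sum l S"
  shows "real \<tau> * sum l UNIV \<le> real CARD('n) * sum l S"
proof -
  have swap: "l j \<le> l i" if "i \<in> S" "j \<notin> S" for i j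
  proof -
    have "card (insert j (S - {i})) = \<tau>" using that S card_Suc_Diff1[of S i] by simp
    from best[OF this] show ?thesis using that by (simp add: sum_diff1)
  qed
  \<comment> \<open>The exchange inequality is summed over all pairs of an inside and an outside
    index. Adding \<open>real \<tau> * sum l S\<close> to both sides later completes the two
    sums.\<close>
  have "real \<tau> * sum l (-S) = (\<Sum>i\<in>S. \<Sum>j\<in>-S. l j)" using S by simp
  also have "\<dots> \<le> (\<Sum>i\<in>S. \<Sum>j\<in>-S. l i)" by (intro sum_mono swap) auto
  also have "\<dots> = real (card (-S)) * sum l S" by (simp add: sum_distrib_left)
  also have "real (card (-S)) = real CARD('n) - real \<tau>"
    using S card_Diff_subset[of S UNIV] card_mono[of UNIV S]
    by (simp add: Compl_eq_Diff_UNIV of_nat_diff)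
  finally have "real \<tau> * (sum l (-S) + sum l S) \<le> real CARD('n) * sum l S"
    by (simp add: algebra_simps)
  moreover have "sum l UNIV = sum l (-S) + sum l S"
    using sum.subset_diff[of S UNIV l] by (simp add: Compl_eq_Diff_UNIV)
  ultimately show ?thesis by simp
qed

text \<open>Each step multiplies by at most \<open>1 - c\<close>, which is bounded by
  \<open>exp (- c)\<close>; nonnegativity of the earlier terms preserves the inequality.\<close>

lemma geometric_decrease:
  fixes a :: "nat \<Rightarrow> real"
  assumes "\<And>k. k < K \<Longrightarrow> a (Suc k) \<le> a k - c * a k" "\<And>k. k < K \<Longrightarrow> 0 \<le> a k"
  shows "a K \<le> a 0 * exp (- (real K * c))"
  using assms
proof (induction K)
  case (Suc K)
  have "a (Suc K) \<le> a K * (1 + (- c))" using Suc.prems(1)[of K] by (simp add: algebra_simps)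
  also have "\<dots> \<le> a K * exp (- c)"
    using Suc.prems(2)[of K] exp_ge_add_one_self[of "- c"] by (intro mult_left_mono) auto
  also have "\<dots> \<le> a 0 * exp (- (real K * c)) * exp (- c)"
    using Suc by (intro mult_right_mono) auto
  also have "\<dots> = a 0 * exp (- (real (Suc K) * c))"
    by (simp add: exp_add [symmetric] algebra_simps)
  finally show ?case .
qed simp

lemma geometric_decrease_log:
  fixes a :: "nat \<Rightarrow> real"
  assumes "\<And>k. k < K \<Longrightarrow> a (Suc k) \<le> a k - c * a k" "\<And>k. k < K \<Longrightarrow> 0 \<le> a k"
    and c: "c > 0" and e: "e > 0" and a0: "a 0 > 0" and K: "real K \<ge> 1 / c * ln (a 0 / e)"
  shows "a K \<le> e"
proof -
  have "ln (a 0 / e) \<le> real K * c" using K c by (simp add: field_simps)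
  then have "exp (- (real K * c)) \<le> exp (- ln (a 0 / e))" by simp
  also have "\<dots> = e / a 0" using e a0 by (simp add: exp_minus)
  finally have "a 0 * exp (- (real K * c)) \<le> e" using a0 by (simp add: field_simps)
  then show ?thesis using geometric_decrease[of K a c] assms(1,2) by force
qed

text \<open>Dividing \<open>a\<^sub>k\<^sub>+\<^sub>1 \<le> a\<^sub>k - c a\<^sub>k\<^sup>2\<close> by \<open>a\<^sub>k a\<^sub>k\<^sub>+\<^sub>1\<close> makes the reciprocals grow linearly.\<close>

lemma quadratic_decrease:
  fixes a :: "nat \<Rightarrow> real"
  assumes "\<And>k. k < K \<Longrightarrow> a (Suc k) \<le> a k - c * (a k)\<^sup>2" "\<And>k. k \<le> K \<Longrightarrow> 0 < a k" "c \<ge> 0"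
  shows "real K * c < 1 / a K"
  using assms
proof (induction K)
  case (Suc K)
  have pos: "a K > 0" "a (Suc K) > 0" and st: "a (Suc K) \<le> a K - c * (a K)\<^sup>2"
    using Suc.prems by auto
  \<comment> \<open>Division turns the decrement into \<open>c * a K / a (Suc K)\<close>, and
    monotonicity bounds this below by \<open>c\<close>.\<close>
  have "a (Suc K) \<le> a K" using st Suc.prems(3) pos by (smt (verit) mult_nonneg_nonneg zero_le_power2)
  then have "c * a K * a (Suc K) \<le> c * a K * a K" using Suc.prems(3) pos by (intro mult_left_mono) auto
  then have "1 / a K + c \<le> 1 / a (Suc K)"
    using st pos by (simp add: field_simps power2_eq_square)
  moreover have "real K * c < 1 / a K" using Suc by auto
  ultimately show ?case by (simp add: algebra_simps)
qed simp

section \<open>Convergence of the greedy iteration\<close>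

theorem mainTheorem6:
  fixes f :: "real^'n \<Rightarrow> real" and M :: "real^'n^'n"
    and g :: "'n \<Rightarrow> real \<Rightarrow> ereal" and xstar :: "real^'n"
    and \<tau> K :: nat and \<epsilon> L :: real
    and F \<xi> \<mu> :: "real^'n \<Rightarrow> ereal" and D :: "(real^'n) set"
    and x v :: "nat \<Rightarrow> real^'n" and S :: "nat \<Rightarrow> 'n set"
  assumes M_spd: "spd M"
    and f_diff: "\<And>y. f differentiable (at y)"
    and f_smooth: "matrix_smooth M f"
    and g_values: "\<And>i t. g i t \<noteq> - \<infinity>"
    and F_def: "F = objective f g"
    and xstar_min: "xstar \<in> argmin_set F" "F xstar > - \<infinity>"
    and xi_def: "\<xi> = (\<lambda>y. F y - F xstar)"
    and tau: "\<tau> \<in> {1..CARD('n)}"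
    and L_def: "L = L_tau M \<tau>"
    and attained: "\<And>y i. y \<in> edom (sep_sum g) \<Longrightarrow> \<exists>w. is_arg_min (coord_model f g L i y) (\<lambda>_. True) w"
    and mu_def: "\<mu> = (\<lambda>y. lam f g L y / \<xi> y)"
    and D_def: "D = edom (sep_sum g) - argmin_set F"
    and x0: "x 0 \<in> edom (sep_sum g)"
    and greedy: "\<And>k. k < K \<Longrightarrow>
           is_arg_max (\<lambda>T. \<Sum>i\<in>T. lam_coord f g L i (x k)) (\<lambda>T. card T = \<tau>) (S k)"
    and minimizer: "\<And>k i. k < K \<Longrightarrow> i \<in> S k \<Longrightarrow>
           is_arg_min (coord_model f g L i (x k)) (\<lambda>_. True) (v k $ i)"
    and update: "\<And>k i. k < K \<Longrightarrow>
           x (Suc k) $ i = (if i \<in> S k then x k $ i + v k $ i else x k $ i)"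
    and eps: "\<epsilon> > 0"
  shows "(\<forall>m::real. m > 0 \<longrightarrow> (\<forall>y\<in>D. \<mu> y \<ge> ereal m) \<longrightarrow>
            ereal (real K) \<ge> ereal (real CARD('n) * L / (m * real \<tau>)) * elog (\<xi> (x 0) / ereal \<epsilon>) \<longrightarrow>
            \<xi> (x K) \<le> ereal \<epsilon>)
       \<and> (\<forall>\<rho> :: real^'n \<Rightarrow> real. (\<forall>y. \<rho> y > 0) \<longrightarrow>
            (\<forall>y\<in>D. \<forall>z\<in>D. \<xi> y \<le> \<xi> z \<longrightarrow> \<mu> y \<ge> ereal (\<rho> z) * \<xi> y) \<longrightarrow>
            real K \<ge> real CARD('n) * L / (\<rho> (x 0) * real \<tau> * \<epsilon>) \<longrightarrow>
            \<xi> (x K) \<le> ereal \<epsilon>)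
       \<and> (ereal (real K) \<ge> \<xi> (x 0) * ereal (real CARD('n) * L / (real \<tau> * \<epsilon>))
                           * elog (\<xi> (x 0) / ereal \<epsilon>) \<longrightarrow>
            \<xi> (x K) \<le> ereal \<epsilon> \<or> (\<exists>k<K. lam f g L (x k) \<le> ereal \<epsilon>))"
proof -
  let ?dom = "edom (sep_sum g)"
  define n where "n = real CARD('n)"
  have n: "n > 0" by (simp add: n_def)
  have \<tau>: "real \<tau> > 0" using tau by simp
  have L: "L > 0" unfolding L_def by (rule L_tau_pos[OF M_spd tau])
  \<comment> \<open>The greedy set carries the fraction \<open>\<tau> / n\<close> of the total, and
    smoothness converts gain into descent with factor \<open>1 / L\<close>.\<close>
  define c where "c = real \<tau> / (n * L)"
  have c: "c > 0" using n \<tau> L by (simp add: c_def)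
  have Fdom: "\<exists>r. F y = ereal r" if "y \<in> ?dom" for y
    using objective_finite[where g=g, OF g_values that, of f] by (simp add: F_def)
  have Fmin: "F xstar \<le> F y" for y
    using xstar_min(1) by (auto simp: argmin_set_def is_arg_min_linorder)
  \<comment> \<open>The minimum is finite: it lies below the finite value at \<open>x 0\<close> and
    above minus infinity by assumption. From here on the gap is the real number
    \<open>X y\<close>.\<close>
  obtain Fs where Fs: "F xstar = ereal Fs"
    using Fmin[of "x 0"] Fdom[OF x0] xstar_min(2) by (cases "F xstar") auto
  define X where "X y = real_of_ereal (F y) - Fs" for y
  define l where "l i y = real_of_ereal (lam_coord f g L i y)" for i y
  define \<Lambda> where "\<Lambda> y = (\<Sum>i\<in>UNIV. l i y)" for y
  have xi: "\<xi> y = ereal (X y)" if "y \<in> ?dom" for y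
    using Fdom[OF that] Fs by (auto simp: X_def xi_def)
  have X0: "X y \<ge> 0" if "y \<in> ?dom" for y
    using Fmin[of y] Fdom[OF that] Fs by (auto simp: X_def)
  have D_iff: "y \<in> D \<longleftrightarrow> X y > 0" if y: "y \<in> ?dom" for y
  proof -
    have "y \<in> argmin_set F \<longleftrightarrow> F y \<le> F xstar"
      using Fmin by (auto simp: argmin_set_def is_arg_min_linorder intro: order_trans)
    also have "\<dots> \<longleftrightarrow> X y \<le> 0"
      using Fdom[OF y] Fs by (auto simp: X_def)
    finally show ?thesis using y by (auto simp: D_def)
  qed
  have l: "lam_coord f g L i y = ereal (l i y)" "0 \<le> l i y" if "y \<in> ?dom" for i y
    using attained[OF that, of i] coord_model_min(1,2)[where g=g, OF g_values that L]
    unfolding l_def by blast+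
  have lam: "lam f g L y = ereal (\<Lambda> y)" "0 \<le> \<Lambda> y" if "y \<in> ?dom" for y
    using l[OF that] by (auto simp: lam_def \<Lambda>_def intro: sum_nonneg)
  \<comment> \<open>Domain membership is proved together with the descent because the next step
    presupposes it; induction then gives it for all iterates.\<close>
  have step: "x (Suc k) \<in> ?dom \<and> X (x (Suc k)) \<le> X (x k) - c * \<Lambda> (x k)"
    if k: "k < K" and dom: "x k \<in> ?dom" for k
  proof -
    have S: "card (S k) = \<tau>" using greedy[OF k] by (simp add: is_arg_max_linorder)
    have ne: "S k \<noteq> {}" using S \<tau> by auto
    note desc = block_step_descent[where S = "S k" and x = "x k" and y = "x (Suc k)"
        and w = "\<lambda>i. v k $ i" and L = L and g = g,
        OF M_spd f_smooth g_values ne _ dom minimizer[OF k] update[OF k], unfolded S, OF L_def]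
    have "sum (\<lambda>i. l i (x k)) T \<le> sum (\<lambda>i. l i (x k)) (S k)" if "card T = \<tau>" for T
      using greedy[OF k] that l(1)[OF dom] by (simp add: is_arg_max_linorder)
    from best_subset_ge_average[OF S this]
    have "real \<tau> * \<Lambda> (x k) \<le> n * (\<Sum>i\<in>S k. l i (x k))" by (simp add: \<Lambda>_def n_def)
    then have "c * \<Lambda> (x k) \<le> (\<Sum>i\<in>S k. l i (x k)) / L"
      using n L by (simp add: c_def field_simps)
    then show ?thesis using desc by (simp add: X_def F_def l_def)
  qed
  have dom: "x k \<in> ?dom" if "k \<le> K" for k
    using that by (induction k) (use x0 step in auto)
  have Xdesc: "X (x (Suc k)) \<le> X (x k) - c * \<Lambda> (x k)" if "k < K" for k
    using step[OF that] dom that by simp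
  have Xmono: "X (x k) \<le> X (x j)" if "j \<le> k" "k \<le> K" for j k
    using that
  proof (induction k rule: dec_induct)
    case (step m)
    then have "0 \<le> c * \<Lambda> (x m)" using lam(2)[OF dom[of m]] c by simp
    then show ?case using Xdesc[of m] step by simp
  qed simp
  \<comment> \<open>Common core of (a) and (c): the proportional bound is asked only along the
    iterates. The logarithm enters only for a positive initial gap; a zero initial gap is settled by
    monotonicity.\<close>
  have geom: "\<xi> (x K) \<le> ereal \<epsilon>"
    if m: "m > 0" "\<And>k. k < K \<Longrightarrow> m * X (x k) \<le> \<Lambda> (x k)"
      and K: "X (x 0) > 0 \<Longrightarrow> real K \<ge> n * L / (m * real \<tau>) * ln (X (x 0) / \<epsilon>)" for m
  proof (cases "X (x 0) > 0")
    case True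
    have "X (x K) \<le> \<epsilon>"
    proof (rule geometric_decrease_log[where a = "\<lambda>k. X (x k)" and c = "c * m"])
      show "X (x (Suc k)) \<le> X (x k) - c * m * X (x k)" if "k < K" for k
        using Xdesc[OF that] mult_left_mono[OF m(2)[OF that] less_imp_le[OF c]]
        unfolding mult.assoc by linarith
      show "0 \<le> X (x k)" if "k < K" for k using X0[OF dom] that by simp
      show "real K \<ge> 1 / (c * m) * ln (X (x 0) / \<epsilon>)" using K[OF True] by (simp add: c_def ac_simps)
    qed (use c m(1) eps True in auto)
    then show ?thesis using xi dom by simp
  next
    case False
    then show ?thesis using Xmono[of 0 K] xi[OF dom[of K]] eps by simp
  qed
  \<comment> \<open>A positive gap makes the extended logarithm real, so the conventions at 0 need
    not be evaluated.\<close>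
  have elog: "elog (\<xi> (x 0) / ereal \<epsilon>) = ereal (ln (X (x 0) / \<epsilon>))" if "X (x 0) > 0"
    using that eps xi[OF x0] by (simp add: elog_def divide_le_0_iff)
  have muD: "\<mu> y = ereal (\<Lambda> y / X y)" if "y \<in> ?dom" "X y > 0" for y
    using that by (simp add: mu_def lam xi)
  show ?thesis
  proof (intro conjI allI impI)
    fix m :: real
    assume m: "m > 0" "\<forall>y\<in>D. \<mu> y \<ge> ereal m"
      and K: "ereal (real K) \<ge> ereal (real CARD('n) * L / (m * real \<tau>)) * elog (\<xi> (x 0) / ereal \<epsilon>)"
    show "\<xi> (x K) \<le> ereal \<epsilon>"
    proof (rule geom[OF m(1)])
      fix k assume "k < K"
      then have d: "x k \<in> ?dom" using dom by simp
      show "m * X (x k) \<le> \<Lambda> (x k)"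
      proof (cases "X (x k) > 0")
        case True
        then have "m \<le> \<Lambda> (x k) / X (x k)" using m(2) D_iff[OF d] muD[OF d] by auto
        then show ?thesis using True by (simp add: field_simps)
      next
        case False
        \<comment> \<open>An optimal iterate lies outside \<open>D\<close>, so the bound on
          \<open>\<mu>\<close> says nothing there; nonnegativity of \<open>\<Lambda>\<close>
          suffices.\<close>
        then have "X (x k) = 0" using X0[OF d] by simp
        then show ?thesis using lam(2)[OF d] by simp
      qed
    next
      assume "X (x 0) > 0"
      then show "real K \<ge> n * L / (m * real \<tau>) * ln (X (x 0) / \<epsilon>)"
        using K elog by (simp add: n_def)
    qed
  next
    fix \<rho> :: "real^'n \<Rightarrow> real"
    assume \<rho>: "\<forall>y. \<rho> y > 0" "\<forall>y\<in>D. \<forall>z\<in>D. \<xi> y \<le> \<xi> z \<longrightarrow> \<mu> y \<ge> ereal (\<rho> z) * \<xi> y"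
      and K: "real K \<ge> real CARD('n) * L / (\<rho> (x 0) * real \<tau> * \<epsilon>)"
    define r where "r = \<rho> (x 0)"
    have r: "r > 0" using \<rho>(1) by (simp add: r_def)
    have "X (x K) \<le> \<epsilon>"
    \<comment> \<open>A positive final gap makes all earlier gaps positive by monotonicity, so every
      iterate lies in \<open>D\<close> and the reciprocals make sense.\<close>
    proof (cases "X (x K) > 0")
      case True
      then have pos: "X (x k) > 0" if "k \<le> K" for k using Xmono[OF that] by simp
      have "real K * (c * r) < 1 / X (x K)"
      proof (rule quadratic_decrease[where a = "\<lambda>k. X (x k)"])
        fix k assume k: "k < K"
        then have d: "x k \<in> ?dom" using dom by simp
        have Xk: "X (x k) > 0" "x k \<in> D" "x 0 \<in> D"
          using pos[of k] pos[of 0] k D_iff[OF d] D_iff[OF x0] by auto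
        \<comment> \<open>Since no gap exceeds the initial one, \<open>\<rho>\<close> can always be
          taken at \<open>x 0\<close>, which gives one constant \<open>r\<close> for all
          steps.\<close>
        moreover have "\<xi> (x k) \<le> \<xi> (x 0)" using Xmono[of 0 k] k xi[OF d] xi[OF x0] by simp
        ultimately have "ereal r * \<xi> (x k) \<le> \<mu> (x k)" using \<rho>(2) unfolding r_def by blast
        then have "r * X (x k) \<le> \<Lambda> (x k) / X (x k)"
          unfolding xi[OF d] muD[OF d Xk(1)] by simp
        then have "r * (X (x k))\<^sup>2 \<le> \<Lambda> (x k)"
          using Xk(1) by (simp add: pos_le_divide_eq power2_eq_square mult.assoc)
        from mult_left_mono[OF this less_imp_le[OF c]] show "X (x (Suc k)) \<le> X (x k) - c * r * (X (x k))\<^sup>2"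
          using Xdesc[OF k] unfolding mult.assoc by linarith
      qed (use pos mult_pos_pos[OF c r] in auto)
      moreover have "1 / \<epsilon> \<le> real K * (c * r)"
        using K n L \<tau> r eps by (simp add: r_def[symmetric] n_def[symmetric] c_def field_simps)
      ultimately have "1 / \<epsilon> < 1 / X (x K)" by linarith
      then show ?thesis using True eps by (simp add: field_simps)
    qed (use eps in auto)
    then show "\<xi> (x K) \<le> ereal \<epsilon>" using xi dom by simp
  next
    assume K: "ereal (real K) \<ge> \<xi> (x 0) * ereal (real CARD('n) * L / (real \<tau> * \<epsilon>))
      * elog (\<xi> (x 0) / ereal \<epsilon>)"
    show "\<xi> (x K) \<le> ereal \<epsilon> \<or> (\<exists>k<K. lam f g L (x k) \<le> ereal \<epsilon>)"
    proof (rule disjCI)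
      assume "\<not> (\<exists>k<K. lam f g L (x k) \<le> ereal \<epsilon>)"
      then have big: "\<epsilon> \<le> \<Lambda> (x k)" if "k < K" for k
        using that lam(1)[OF dom[of k]] by (auto simp: not_le less_imp_le)
      show "\<xi> (x K) \<le> ereal \<epsilon>"
      proof (cases "X (x 0) > 0")
        case True
        show ?thesis
        proof (rule geom)
          show "\<epsilon> / X (x 0) > 0" using True eps by simp
          show "\<epsilon> / X (x 0) * X (x k) \<le> \<Lambda> (x k)" if "k < K" for k
          proof -
            have "\<epsilon> / X (x 0) * X (x k) \<le> \<epsilon> / X (x 0) * X (x 0)"
              using Xmono[of 0 k] that True eps by (intro mult_left_mono) auto
            then show ?thesis using big[OF that] True by simp
          qed
          \<comment> \<open>With \<open>m = \<epsilon> / X (x 0)\<close> the factor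
            \<open>n * L / (m * real \<tau>)\<close> is the initial gap times
            \<open>n * L / (real \<tau> * \<epsilon>)\<close>.\<close>
          show "real K \<ge> n * L / (\<epsilon> / X (x 0) * real \<tau>) * ln (X (x 0) / \<epsilon>)"
            using K elog[OF True] xi[OF x0] by (simp add: n_def ac_simps)
        qed
      next
        case False
        then show ?thesis using Xmono[of 0 K] xi[OF dom[of K]] eps by simp
      qed
    qed
  qed
qed

end
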